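(* Let $(\mathcal{S},\mathcal{A},\mathcal{P},r)$ be a weakly communicating average reward MDP, let $Q^*$ be any solution of Bellman's equation $Q^*=\mathcal{T}(Q^* )-g^*$, let $Q^0\in\mathbb{R}^{\mathcal{S}\times\mathcal{A}}$, $\varepsilon>0$, $\delta\in(0,1)$, and set $\mu=\|Q^0-Q^*\|_{\mathrm{sp}}$. Let $N$ be the stopping time of $\mathrm{SAVIA}\textbf{+}(Q^0,\varepsilon,\delta)$, run with $c_k=5(k+2)\ln^2(k+2)$ and $\beta_k=k/(k+2)$. Then $$\mathbb{E}[N]\le\frac{2(1+\mu/\varepsilon)}{1-\delta}.$$ In particular $N$ is finite almost surely and $\mathrm{SAVIA}\textbf{+}(Q^0,\varepsilon,\delta)$ stops with probability $1$ after finitely many loops.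
   Context: An average reward MDP $(\mathcal{S},\mathcal{A},\mathcal{P},r)$ has finite nonempty state space $\mathcal{S}$, finite nonempty action space $\mathcal{A}$, transition kernel $\mathcal{P}$ (each $\mathcal{P}(\cdot|s,a)$ is a probability distribution on $\mathcal{S}$) and reward $r:\mathcal{S}\times\mathcal{A}\to\mathbb{R}$. A policy is a map $\pi:\mathcal{S}\to\mathcal{A}$, with gain $g_\pi(s)=\lim_{n\to\infty}\mathbb{E}_\pi\big[\frac1n\sum_{t=0}^{n-1}r(s_t,a_t)|s_0=s\big]$, where $a_t=\pi(s_t)$, $s_{t+1}\sim\mathcal{P}(\cdot|s_t,a_t)$. The optimal gain is $g^*(s)=\max_\pi g_\pi(s)$. The MDP is weakly communicating if there is a set of states such that each state of the set is accessible from every other state of the set under some policy, and all remaining states (possibly none) are transient under every policy; then $g^*(s)\equiv g^*\in\mathbb{R}$ is constant. Notation: $\|x\|_{\mathrm{sp}}=\max_jx(j)-\min_jx(j)$. $\max_{\mathcal{A}}(Q)(s)=\max_{a}Q(s,a)$. $\mathcal{T}(Q)(s,a)=r(s,a)+\sum_{s'}\mathcal{P}(s'|s,a)\max_{\mathcal{A}}(Q)(s')$. The Bellman equation $Q=\mathcal{T}(Q)-g^*$ always has solutions. Subroutine $\mathrm{SAMPLE}(d,m)$, $d\in\mathbb{R}^{\mathcal{S}}$, $m\ge1$ integer: for each $(s,a)$ draw $m$ fresh i.i.d. samples $s_1,\dots,s_m\sim\mathcal{P}(\cdot|s,a)$ (independent of the past) and return the matrix $D(s,a)=\frac1m\sum_{j=1}^m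 d(s_j)$. Algorithm $\mathrm{SAVIA}(Q^0,n,\varepsilon,\delta)$ (with sequences $c_k,\beta_k$): set $\alpha=\ln(2|\mathcal{S}||\mathcal{A}|(n+1)/\delta)$, $T^{-1}=r$, $h^{-1}=0$, $\beta_0=0$. For $k=0,\dots,n$: $Q^k=(1-\beta_k)Q^0+\beta_kT^{k-1}$; $h^k=\max_{\mathcal{A}}(Q^k)$; $d^k=h^k-h^{k-1}$; $m_k=\max\{\lceil\alpha c_k\|d^k\|_{\mathrm{sp}}^2/\varepsilon^2\rceil,1\}$; $D^k=\mathrm{SAMPLE}(d^k,m_k)$; $T^k=T^{k-1}+D^k$. Finally choose $\pi^n(s)\in\operatorname{argmax}_aQ^n(s,a)$ and output $(Q^n,T^n,\pi^n)$. Algorithm $\mathrm{SAVIA}\textbf{+}(Q^0,\varepsilon,\delta)$: for $i=0,1,2,\dots$ set $n_i=2^i$, $\delta_i=\delta/c_i$, and run $\mathrm{SAVIA}(Q^0,n_i,\varepsilon,\delta_i)$ afresh (with samples independent of earlier loops) to get $(Q^{n_i},T^{n_i},\pi^{n_i})$; stop at the first $i$ with $\|Q^{n_i}-T^{n_i}\|_{\mathrm{sp}}\le14\varepsilon$. The stopping time is $N=\inf\{n_i:\|Q^{n_i}-T^{n_i}\|_{\mathrm{sp}}\le14\varepsilon\}$ ($=+\infty$ if there is no such $i$). *)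

theory Defs
  imports "HOL-Probability.Probability"
begin

definition sp :: "('i::finite \<Rightarrow> real) \<Rightarrow> real" where
  "sp x = (MAX j. x j) - (MIN j. x j)"

definition maxA :: "('s \<times> 'a::finite \<Rightarrow> real) \<Rightarrow> 's \<Rightarrow> real" where
  "maxA Q s = (MAX a. Q (s, a))"

text \<open>
  An MDP is given by a kernel \<open>P\<close> and a reward \<open>r\<close> over finite types of states and actions.
  \<open>traj P \<pi> s n\<close> is the law of the list \<open>[s\<^sub>0, \<dots>, s\<^sub>n]\<close> of the first \<open>n + 1\<close> states visited when
  following \<open>\<pi>\<close> from \<open>s\<^sub>0 = s\<close>.
\<close>

primrec traj :: "('s \<times> 'a \<Rightarrow> 's pmf) \<Rightarrow> ('s \<Rightarrow> 'a) \<Rightarrow> 's \<Rightarrow> nat \<Rightarrow> 's list pmf" where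
  "traj P \<pi> s 0 = return_pmf [s]"
| "traj P \<pi> s (Suc n) =
     bind_pmf (P (s, \<pi> s)) (\<lambda>s'. map_pmf (\<lambda>xs. s # xs) (traj P \<pi> s' n))"

definition gain :: "('s \<times> 'a \<Rightarrow> 's pmf) \<Rightarrow> ('s \<times> 'a \<Rightarrow> real) \<Rightarrow> ('s \<Rightarrow> 'a) \<Rightarrow> 's \<Rightarrow> real" where
  "gain P r \<pi> s =
     lim (\<lambda>n. measure_pmf.expectation (traj P \<pi> s n)
                (\<lambda>xs. (1 / real n) * (\<Sum>t<n. r (xs ! t, \<pi> (xs ! t)))))"

definition opt_gain ::
  "('s::finite \<times> 'a::finite \<Rightarrow> 's pmf) \<Rightarrow> ('s \<times> 'a \<Rightarrow> real) \<Rightarrow> 's \<Rightarrow> real" where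
  "opt_gain P r s = (MAX \<pi>. gain P r \<pi> s)"

text \<open>
  The common value of the optimal gain over all states. It is only meaningful when the optimal gain
  does not depend on the state, as is the case for weakly communicating MDPs.
\<close>

definition gstar :: "('s::finite \<times> 'a::finite \<Rightarrow> 's pmf) \<Rightarrow> ('s \<times> 'a \<Rightarrow> real) \<Rightarrow> real" where
  "gstar P r = (THE g. \<forall>s. opt_gain P r s = g)"

definition accessible :: "('s \<times> 'a \<Rightarrow> 's pmf) \<Rightarrow> ('s \<Rightarrow> 'a) \<Rightarrow> 's \<Rightarrow> 's \<Rightarrow> bool" where
  "accessible P \<pi> s s' \<longleftrightarrow>
     (\<exists>n. measure_pmf.prob (traj P \<pi> s n) {xs. xs ! n = s'} > 0)"

text \<open>
  By continuity from below, the supremum is the probability that the infinite chain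
  started in \<open>s\<close> ever returns to \<open>s\<close>.
\<close>

definition return_prob :: "('s \<times> 'a \<Rightarrow> 's pmf) \<Rightarrow> ('s \<Rightarrow> 'a) \<Rightarrow> 's \<Rightarrow> real" where
  "return_prob P \<pi> s =
     (SUP n. measure_pmf.prob (traj P \<pi> s n) {xs. \<exists>t\<in>{1..n}. xs ! t = s})"

definition transient :: "('s \<times> 'a \<Rightarrow> 's pmf) \<Rightarrow> ('s \<Rightarrow> 'a) \<Rightarrow> 's \<Rightarrow> bool" where
  "transient P \<pi> s \<longleftrightarrow> return_prob P \<pi> s < 1"

definition weakly_communicating :: "('s \<times> 'a \<Rightarrow> 's pmf) \<Rightarrow> bool" where
  "weakly_communicating P \<longleftrightarrow>
     (\<exists>C. (\<forall>s\<in>C. \<forall>s'\<in>C. s \<noteq> s' \<longrightarrow> (\<exists>\<pi>. accessible P \<pi> s s')) \<and>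
          (\<forall>s. s \<notin> C \<longrightarrow> (\<forall>\<pi>. transient P \<pi> s)))"

definition bellman_op ::
  "('s::finite \<times> 'a::finite \<Rightarrow> 's pmf) \<Rightarrow> ('s \<times> 'a \<Rightarrow> real) \<Rightarrow> ('s \<times> 'a \<Rightarrow> real) \<Rightarrow> 's \<times> 'a \<Rightarrow> real"
where
  "bellman_op P r Q sa = r sa + (\<Sum>s'\<in>UNIV. pmf (P sa) s' * maxA Q s')"

text \<open>
  All samples, for all state-action pairs, are drawn independently; the second argument of
  \<open>Pi_pmf\<close> is a dummy value that is never used, the index set being the whole type.
\<close>

definition SAMPLE ::
  "('s::finite \<times> 'a::finite \<Rightarrow> 's pmf) \<Rightarrow> ('s \<Rightarrow> real) \<Rightarrow> nat \<Rightarrow> ('s \<times> 'a \<Rightarrow> real) pmf" where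
  "SAMPLE P d m =
     map_pmf (\<lambda>X sa. (1 / real m) * (\<Sum>j<m. d (X sa ! j)))
       (Pi_pmf UNIV [] (\<lambda>sa. replicate_pmf m (P sa)))"

text \<open>
  The state of SAVIA after step \<open>k\<close> is \<open>(Q\<^sup>k, T\<^sup>k, h\<^sup>k)\<close>. One step computes it from
  \<open>T\<^sup>k\<^sup>-\<^sup>1\<close> and \<open>h\<^sup>k\<^sup>-\<^sup>1\<close>; step \<open>0\<close> starts from \<open>T\<^sup>-\<^sup>1 = r\<close> and \<open>h\<^sup>-\<^sup>1 = 0\<close>.
\<close>

type_synonym ('s, 'a) savia_state = "('s \<times> 'a \<Rightarrow> real) \<times> ('s \<times> 'a \<Rightarrow> real) \<times> ('s \<Rightarrow> real)"

definition savia_step ::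
  "('s::finite \<times> 'a::finite \<Rightarrow> 's pmf) \<Rightarrow> (nat \<Rightarrow> real) \<Rightarrow> (nat \<Rightarrow> real) \<Rightarrow> ('s \<times> 'a \<Rightarrow> real) \<Rightarrow>
   real \<Rightarrow> real \<Rightarrow> nat \<Rightarrow> ('s \<times> 'a \<Rightarrow> real) \<Rightarrow> ('s \<Rightarrow> real) \<Rightarrow> ('s, 'a) savia_state pmf" where
  "savia_step P c \<beta> Q0 \<alpha> \<epsilon> k T h =
     (let Q = (\<lambda>sa. (1 - \<beta> k) * Q0 sa + \<beta> k * T sa);
          h' = maxA Q;
          d = (\<lambda>s. h' s - h s);
          m = max (nat \<lceil>\<alpha> * c k * (sp d)\<^sup>2 / \<epsilon>\<^sup>2\<rceil>) 1
      in map_pmf (\<lambda>D. (Q, \<lambda>sa. T sa + D sa, h')) (SAMPLE P d m))"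

primrec savia_iter ::
  "('s::finite \<times> 'a::finite \<Rightarrow> 's pmf) \<Rightarrow> ('s \<times> 'a \<Rightarrow> real) \<Rightarrow> (nat \<Rightarrow> real) \<Rightarrow> (nat \<Rightarrow> real) \<Rightarrow>
   ('s \<times> 'a \<Rightarrow> real) \<Rightarrow> real \<Rightarrow> real \<Rightarrow> nat \<Rightarrow> ('s, 'a) savia_state pmf" where
  "savia_iter P r c \<beta> Q0 \<alpha> \<epsilon> 0 = savia_step P c \<beta> Q0 \<alpha> \<epsilon> 0 r (\<lambda>_. 0)"
| "savia_iter P r c \<beta> Q0 \<alpha> \<epsilon> (Suc k) =
     bind_pmf (savia_iter P r c \<beta> Q0 \<alpha> \<epsilon> k)
       (\<lambda>(Q, T, h). savia_step P c \<beta> Q0 \<alpha> \<epsilon> (Suc k) T h)"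

type_synonym ('s, 'a) savia_output = "('s \<times> 'a \<Rightarrow> real) \<times> ('s \<times> 'a \<Rightarrow> real) \<times> ('s \<Rightarrow> 'a)"

text \<open>
  The argument \<open>greedy\<close> is the tie-breaking rule by which SAVIA chooses its output policy
  from \<open>Q\<^sup>n\<close>.
\<close>

definition is_greedy_choice :: "(('s \<times> 'a \<Rightarrow> real) \<Rightarrow> 's \<Rightarrow> 'a) \<Rightarrow> bool" where
  "is_greedy_choice greedy \<longleftrightarrow> (\<forall>Q s. is_arg_max (\<lambda>a. Q (s, a)) (\<lambda>_. True) (greedy Q s))"

definition SAVIA ::
  "('s::finite \<times> 'a::finite \<Rightarrow> 's pmf) \<Rightarrow> ('s \<times> 'a \<Rightarrow> real) \<Rightarrow> (nat \<Rightarrow> real) \<Rightarrow> (nat \<Rightarrow> real) \<Rightarrow>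
   (('s \<times> 'a \<Rightarrow> real) \<Rightarrow> 's \<Rightarrow> 'a) \<Rightarrow> ('s \<times> 'a \<Rightarrow> real) \<Rightarrow> nat \<Rightarrow> real \<Rightarrow> real \<Rightarrow>
   ('s, 'a) savia_output pmf" where
  "SAVIA P r c \<beta> greedy Q0 n \<epsilon> \<delta> =
     (let \<alpha> = ln (2 * real CARD('s) * real CARD('a) * (real n + 1) / \<delta>)
      in map_pmf (\<lambda>(Q, T, h). (Q, T, greedy Q)) (savia_iter P r c \<beta> Q0 \<alpha> \<epsilon> n))"

text \<open>
  A sample point of SAVIA+ is the sequence of outputs of independent runs of SAVIA, the \<open>i\<close>-th one
  with horizon \<open>2 ^ i\<close> and confidence \<open>\<delta> / c i\<close>. The algorithm only inspects
  this sequence up to the first index at which the stopping criterion holds.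
\<close>

definition SAVIA_plus ::
  "('s::finite \<times> 'a::finite \<Rightarrow> 's pmf) \<Rightarrow> ('s \<times> 'a \<Rightarrow> real) \<Rightarrow> (nat \<Rightarrow> real) \<Rightarrow> (nat \<Rightarrow> real) \<Rightarrow>
   (('s \<times> 'a \<Rightarrow> real) \<Rightarrow> 's \<Rightarrow> 'a) \<Rightarrow> ('s \<times> 'a \<Rightarrow> real) \<Rightarrow> real \<Rightarrow> real \<Rightarrow>
   (nat \<Rightarrow> ('s, 'a) savia_output) measure" where
  "SAVIA_plus P r c \<beta> greedy Q0 \<epsilon> \<delta> =
     (\<Pi>\<^sub>M i\<in>UNIV. measure_pmf (SAVIA P r c \<beta> greedy Q0 (2 ^ i) \<epsilon> (\<delta> / c i)))"

definition stop_criterion :: "real \<Rightarrow> ('s::finite, 'a::finite) savia_output \<Rightarrow> bool" where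
  "stop_criterion \<epsilon> = (\<lambda>(Q, T, \<pi>). sp (\<lambda>sa. Q sa - T sa) \<le> 14 * \<epsilon>)"

definition stops_at_loop ::
  "real \<Rightarrow> nat \<Rightarrow> (nat \<Rightarrow> ('s::finite, 'a::finite) savia_output) \<Rightarrow> bool" where
  "stops_at_loop \<epsilon> i \<omega> \<longleftrightarrow> stop_criterion \<epsilon> (\<omega> i) \<and> (\<forall>j<i. \<not> stop_criterion \<epsilon> (\<omega> j))"

definition savia_plus_N :: "real \<Rightarrow> (nat \<Rightarrow> ('s::finite, 'a::finite) savia_output) \<Rightarrow> enat" where
  "savia_plus_N \<epsilon> \<omega> = Inf {enat (2 ^ i) | i. stop_criterion \<epsilon> (\<omega> i)}"

lemma savia_plus_N_eq:
  "savia_plus_N \<epsilon> \<omega> =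
     (if \<exists>i. stop_criterion \<epsilon> (\<omega> i) then enat (2 ^ (LEAST i. stop_criterion \<epsilon> (\<omega> i))) else \<infinity>)"
proof (cases "\<exists>i. stop_criterion \<epsilon> (\<omega> i)")
  case True
  let ?L = "LEAST i. stop_criterion \<epsilon> (\<omega> i)"
  have L: "stop_criterion \<epsilon> (\<omega> ?L)"
    using True by (rule LeastI_ex)
  have "savia_plus_N \<epsilon> \<omega> = enat (2 ^ ?L)"
    unfolding savia_plus_N_def
  proof (rule antisym)
    show "Inf {enat (2 ^ i) | i. stop_criterion \<epsilon> (\<omega> i)} \<le> enat (2 ^ ?L)"
      using L by (intro Inf_lower) auto
    show "enat (2 ^ ?L) \<le> Inf {enat (2 ^ i) | i. stop_criterion \<epsilon> (\<omega> i)}"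
      by (rule Inf_greatest) (auto intro!: power_increasing Least_le)
  qed
  then show ?thesis using True by simp
next
  case False
  then show ?thesis by (simp add: savia_plus_N_def top_enat_def)
qed

lemma prob_space_SAVIA_plus: "prob_space (SAVIA_plus P r c \<beta> greedy Q0 \<epsilon> \<delta>)"
  unfolding SAVIA_plus_def by (intro prob_space_PiM measure_pmf.prob_space_axioms)

lemma measurable_stop_criterion:
  "(\<lambda>\<omega>. stop_criterion \<epsilon> (\<omega> i))
     \<in> measurable (SAVIA_plus P r c \<beta> greedy Q0 \<epsilon> \<delta>) (count_space UNIV)"
  unfolding SAVIA_plus_def
  by (rule measurable_compose[OF measurable_component_singleton]) auto

lemma measurable_savia_plus_N:
  "savia_plus_N \<epsilon> \<in> measurable (SAVIA_plus P r c \<beta> greedy Q0 \<epsilon> \<delta>) (count_space UNIV)"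
proof -
  note [measurable] = measurable_stop_criterion
  show ?thesis
    unfolding savia_plus_N_eq[abs_def] by measurable
qed

end

theory Submission
  imports Defs
begin

text \<open>
  On the event that \<open>\<bar>T\<^sup>k - \<T>(Q\<^sup>k)\<bar> \<le> \<epsilon>\<close> for all \<open>k \<le> n\<close>, SAVIA is a Halpern iteration with errors of span
  at most \<open>e = 2\<epsilon>\<close> of a map that is nonexpansive in the span seminorm. Such errors could accumulate
  in the increments of \<open>Q\<^sup>k\<close>, but \<open>T\<^sup>k - T\<^sup>k\<^sup>-\<^sup>1 = D\<^sup>k\<close> consists of averages of values of \<open>d\<^sup>k\<close>, so that
  \<open>sp (T\<^sup>k - T\<^sup>k\<^sup>-\<^sup>1) \<le> sp d\<^sup>k \<le> sp (Q\<^sup>k - Q\<^sup>k\<^sup>-\<^sup>1)\<close> holds surely. The errors then only enter through the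
  anchoring term, whence \<open>sp (Q\<^sup>n - T\<^sup>n) \<le> 8\<mu> / (n + 2) + 2\<epsilon>\<close>, which is below \<open>14\<epsilon>\<close> as soon as
  \<open>n \<ge> \<mu> / \<epsilon>\<close>.

  The sampling errors form a martingale whose conditional moment generating functions are bounded
  by Hoeffding's lemma; the choice of \<open>m\<^sub>k\<close> and \<open>\<Sum>k. 1 / c\<^sub>k \<le> 2\<close> make the event fail with
  probability at most \<open>\<delta>\<^sub>i\<close> in loop \<open>i\<close>. As \<open>\<delta>\<^sub>i \<le> \<delta> / 2\<close>, the doubling of \<open>n\<^sub>i\<close> in the expectation
  of \<open>N\<close> is absorbed and a geometric series of ratio \<open>\<delta>\<close> remains.
\<close>

section \<open>Span seminorm and nonexpansiveness of the Bellman operator\<close>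

lemma sp_ge: "x i - x j \<le> sp x" for x :: "'i::finite \<Rightarrow> real"
proof -
  have "x i \<le> (MAX j. x j)" "(MIN j. x j) \<le> x j"
    by (auto intro!: Max_ge Min_le)
  then show ?thesis unfolding sp_def by linarith
qed

lemma sp_le: "(\<And>i j. x i - x j \<le> B) \<Longrightarrow> sp x \<le> B" for x :: "'i::finite \<Rightarrow> real"
proof -
  assume *: "\<And>i j. x i - x j \<le> B"
  have "(MAX j. x j) \<in> range x" "(MIN j. x j) \<in> range x"
    by (auto intro!: Max_in Min_in)
  then show "sp x \<le> B" unfolding sp_def using * by (metis imageE)
qed

lemma sp_nonneg: "0 \<le> sp x"
  using sp_ge[of x undefined undefined] by simp

lemma sp_comb:
  assumes "0 \<le> a" "0 \<le> b"
  shows "sp (\<lambda>i. a * x i + b * y i) \<le> a * sp x + b * sp y"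
proof (rule sp_le)
  fix i j
  have "a * (x i - x j) + b * (y i - y j) \<le> a * sp x + b * sp y"
    by (intro add_mono mult_left_mono sp_ge assms)
  then show "a * x i + b * y i - (a * x j + b * y j) \<le> a * sp x + b * sp y"
    by (simp add: algebra_simps)
qed

lemma sp_minus: "sp (\<lambda>i. - x i) = sp x"
proof (rule antisym)
  show "sp (\<lambda>i. - x i) \<le> sp x"
    by (rule sp_le) (use sp_ge[of x] in \<open>simp add: algebra_simps\<close>)
  show "sp x \<le> sp (\<lambda>i. - x i)"
    by (rule sp_le) (use sp_ge[of "\<lambda>i. - x i"] in \<open>simp add: algebra_simps\<close>)
qed

lemma sp_diff_commute: "sp (\<lambda>i. x i - y i) = sp (\<lambda>i. y i - x i)"
  using sp_minus[of "\<lambda>i. x i - y i"] by simp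

lemma sp_triangle: "sp (\<lambda>i. x i - z i) \<le> sp (\<lambda>i. x i - y i) + sp (\<lambda>i. y i - z i)"
  using sp_comb[of 1 1 "\<lambda>i. x i - y i" "\<lambda>i. y i - z i"] by simp

lemma sp_le_abs:
  assumes "\<And>i. \<bar>x i\<bar> \<le> B"
  shows "sp x \<le> 2 * B"
proof (rule sp_le)
  fix i j
  show "x i - x j \<le> 2 * B" using assms[of i] assms[of j] by linarith
qed

lemma maxA_ge: "Q (s, a) \<le> maxA Q s"
  unfolding maxA_def by (intro Max_ge) auto

lemma maxA_attained: "\<exists>a. maxA Q s = Q (s, a)"
proof -
  have "maxA Q s \<in> range (\<lambda>a. Q (s, a))"
    unfolding maxA_def by (intro Max_in) auto
  then show ?thesis by auto
qed

text \<open>Take a maximiser \<open>a\<close> of \<open>Q\<close> at \<open>s\<close> and a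
  maximiser \<open>b\<close> of \<open>Q'\<close> at \<open>t\<close>. Then
  \<open>maxA Q s - maxA Q' s\<close> is at most the entry of \<open>Q - Q'\<close> at
  \<open>(s, a)\<close>, while \<open>maxA Q t - maxA Q' t\<close> is at least its entry at
  \<open>(t, b)\<close>.\<close>

lemma sp_maxA: "sp (\<lambda>s. maxA Q s - maxA Q' s) \<le> sp (\<lambda>sa. Q sa - Q' sa)"
  for Q :: "'s::finite \<times> 'a::finite \<Rightarrow> real"
proof (rule sp_le)
  fix s t
  obtain a where a: "maxA Q s = Q (s, a)" using maxA_attained[of Q s] by blast
  obtain b where b: "maxA Q' t = Q' (t, b)" using maxA_attained[of Q' t] by blast
  have "Q (s, a) - Q' (s, a) - (Q (t, b) - Q' (t, b)) \<le> sp (\<lambda>sa. Q sa - Q' sa)"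
    using sp_ge[of "\<lambda>sa. Q sa - Q' sa" "(s, a)" "(t, b)"] by simp
  then show "maxA Q s - maxA Q' s - (maxA Q t - maxA Q' t) \<le> sp (\<lambda>sa. Q sa - Q' sa)"
    using a b maxA_ge[of Q' s a] maxA_ge[of Q t b] by linarith
qed

lemma pmf_average_le:
  fixes f :: "'s::finite \<Rightarrow> real"
  assumes "\<And>s. f s \<le> B"
  shows "(\<Sum>s\<in>UNIV. pmf p s * f s) \<le> B"
proof -
  have "(\<Sum>s\<in>UNIV. pmf p s * f s) \<le> (\<Sum>s\<in>UNIV. pmf p s * B)"
    by (intro sum_mono mult_left_mono assms) auto
  also have "\<dots> = B"
    by (simp add: sum_pmf_eq_1 flip: sum_distrib_right)
  finally show ?thesis .
qed

lemma pmf_average_diff_le_sp: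
  fixes f :: "'s::finite \<Rightarrow> real"
  shows "(\<Sum>s\<in>UNIV. pmf p s * f s) - (\<Sum>s\<in>UNIV. pmf q s * f s) \<le> sp f"
proof -
  have "(\<Sum>s\<in>UNIV. pmf p s * f s) \<le> (MAX s. f s)"
    by (rule pmf_average_le) (auto intro!: Max_ge)
  moreover have "(\<Sum>s\<in>UNIV. pmf q s * - f s) \<le> - (MIN s. f s)"
  proof (rule pmf_average_le)
    fix s
    have "(MIN s. f s) \<le> f s" by (rule Min_le) auto
    then show "- f s \<le> - (MIN s. f s)" by simp
  qed
  ultimately show ?thesis unfolding sp_def mult_minus_right sum_negf by linarith
qed

text \<open>The reward cancels, leaving averages of \<open>maxA Q - maxA Q'\<close> under the laws
  \<open>P sa\<close>; averages of one function under two laws differ by at most its span.\<close>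

lemma sp_bellman_op:
  "sp (\<lambda>sa. bellman_op P r Q sa - bellman_op P r Q' sa) \<le> sp (\<lambda>sa. Q sa - Q' sa)"
proof -
  have *: "bellman_op P r Q sa - bellman_op P r Q' sa =
      (\<Sum>s\<in>UNIV. pmf (P sa) s * (maxA Q s - maxA Q' s))" for sa
    by (simp add: bellman_op_def sum_subtractf right_diff_distrib)
  have "sp (\<lambda>sa. bellman_op P r Q sa - bellman_op P r Q' sa) \<le> sp (\<lambda>s. maxA Q s - maxA Q' s)"
    unfolding * by (rule sp_le) (rule pmf_average_diff_le_sp)
  also note sp_maxA
  finally show ?thesis .
qed

section \<open>Error bounds for the Halpern recursion with sampled increments\<close>

lemma sp_SAMPLE:
  assumes "D \<in> set_pmf (SAMPLE P d m)" "1 \<le> m"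
  shows "sp D \<le> sp d"
proof (rule sp_le)
  obtain X where D: "D = (\<lambda>sa. (1 / real m) * (\<Sum>j<m. d (X sa ! j)))"
    using assms(1) unfolding SAMPLE_def by auto
  fix sa sb
  \<comment> \<open>Both averages have \<open>m\<close> terms, so they are compared sample by
    sample, for every possible outcome.\<close>
  have "(\<Sum>j<m. d (X sa ! j) - d (X sb ! j)) \<le> (\<Sum>j<m. sp d)"
    by (intro sum_mono sp_ge)
  then show "D sa - D sb \<le> sp d"
    using assms(2) by (simp add: D field_simps sum_subtractf)
qed

text \<open>
  The second conjunct bounds \<open>sp (Q\<^sup>k\<^sup>+\<^sup>1 - Q\<^sup>k)\<close>, since \<open>1 - \<beta>\<^sub>k\<^sub>+\<^sub>1 = 2 / (k + 3)\<close>.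
\<close>

definition savia_inv ::
  "('s::finite \<times> 'a::finite \<Rightarrow> real) \<Rightarrow> ('s \<times> 'a \<Rightarrow> real) \<Rightarrow> real \<Rightarrow> real \<Rightarrow> nat \<Rightarrow>
   ('s, 'a) savia_state \<Rightarrow> bool" where
  "savia_inv Q0 Qs \<mu> e k = (\<lambda>(Q, T, h).
     sp (\<lambda>sa. Q sa - Qs sa) \<le> \<mu> + e * real k / 3 \<and>
     sp (\<lambda>sa. (2 / (real k + 3) * Q0 sa + (real k + 1) / (real k + 3) * T sa) - Q sa)
       \<le> 4 * \<mu> / (real k + 2) + e / 3 \<and>
     sp (\<lambda>sa. Q sa - T sa) \<le> 8 * \<mu> / (real k + 2) + e)"

text \<open>Spans ignore the constant \<open>g\<close>, so \<open>Qs\<close> acts as a fixed point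
  of the Bellman operator. Nonexpansiveness and the triangle inequality through
  \<open>bellman_op P r Q\<close> give the first bound; passing through \<open>Qs\<close> gives the
  second.\<close>

lemma sp_diff_anchor_le:
  assumes \<mu>: "sp (\<lambda>sa. Q0 sa - Qs sa) \<le> \<mu>"
    and fixpoint: "\<And>sa. Qs sa = bellman_op P r Qs sa - g"
    and T: "sp (\<lambda>sa. T sa - bellman_op P r Q sa) \<le> e"
  shows "sp (\<lambda>sa. T sa - Qs sa) \<le> e + sp (\<lambda>sa. Q sa - Qs sa)"
    and "sp (\<lambda>sa. T sa - Q0 sa) \<le> e + sp (\<lambda>sa. Q sa - Qs sa) + \<mu>"
proof -
  have "sp (\<lambda>sa. bellman_op P r Q sa - Qs sa) \<le> sp (\<lambda>sa. bellman_op P r Q sa - bellman_op P r Qs sa)"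
  proof (rule sp_le)
    fix i j
    show "bellman_op P r Q i - Qs i - (bellman_op P r Q j - Qs j)
        \<le> sp (\<lambda>sa. bellman_op P r Q sa - bellman_op P r Qs sa)"
      using sp_ge[of "\<lambda>sa. bellman_op P r Q sa - bellman_op P r Qs sa" i j]
        fixpoint[of i] fixpoint[of j] by linarith
  qed
  also have "\<dots> \<le> sp (\<lambda>sa. Q sa - Qs sa)" by (rule sp_bellman_op)
  finally show *: "sp (\<lambda>sa. T sa - Qs sa) \<le> e + sp (\<lambda>sa. Q sa - Qs sa)"
    using sp_triangle[of T Qs "bellman_op P r Q"] T by linarith
  show "sp (\<lambda>sa. T sa - Q0 sa) \<le> e + sp (\<lambda>sa. Q sa - Qs sa) + \<mu>"
    using * sp_triangle[of T Q0 Qs] \<mu> sp_diff_commute[of Qs Q0] by linarith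
qed

lemma savia_inv_0:
  assumes \<mu>: "sp (\<lambda>sa. Q0 sa - Qs sa) \<le> \<mu>"
    and fixpoint: "\<And>sa. Qs sa = bellman_op P r Qs sa - g"
    and T: "sp (\<lambda>sa. T sa - bellman_op P r Q0 sa) \<le> e"
  shows "savia_inv Q0 Qs \<mu> e 0 (Q0, T, h)"
proof -
  have TQ: "sp (\<lambda>sa. T sa - Q0 sa) \<le> 2 * \<mu> + e"
    using sp_diff_anchor_le(2)[OF assms] \<mu> by linarith
  have "0 \<le> \<mu>" "0 \<le> e" using order_trans[OF sp_nonneg \<mu>] order_trans[OF sp_nonneg T] by auto
  \<comment> \<open>The first increment is a third of \<open>T - Q0\<close>; the zero summand only
    provides the shape of \<open>sp_comb\<close>.\<close>
  have "sp (\<lambda>sa. (2 / 3 * Q0 sa + 1 / 3 * T sa) - Q0 sa) = sp (\<lambda>sa. 1 / 3 * (T sa - Q0 sa) + 0 * Q0 sa)"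
    by (rule arg_cong[of _ _ sp]) (auto simp: algebra_simps)
  also have "\<dots> \<le> 1 / 3 * sp (\<lambda>sa. T sa - Q0 sa) + 0 * sp Q0"
    by (rule sp_comb) auto
  also have "\<dots> \<le> 2 * \<mu> + e / 3" using TQ \<open>0 \<le> \<mu>\<close> by simp
  finally have "sp (\<lambda>sa. (2 / 3 * Q0 sa + 1 / 3 * T sa) - Q0 sa) \<le> 2 * \<mu> + e / 3" .
  then show ?thesis
    using TQ \<mu> \<open>0 \<le> \<mu>\<close> \<open>0 \<le> e\<close> by (simp add: savia_inv_def sp_diff_commute[of Q0 T])
qed

text \<open>\<open>Q\<close> and \<open>T\<close> belong to step \<open>k\<close>, \<open>Q'\<close>
  and \<open>T'\<close> to step \<open>k + 1\<close>. The distance to \<open>Qs\<close> may grow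
  linearly in \<open>k\<close>, but it enters the increment and the residual only through the
  anchor, whose weights decay fast enough to keep its contribution bounded.\<close>

lemma savia_inv_Suc:
  assumes \<mu>: "sp (\<lambda>sa. Q0 sa - Qs sa) \<le> \<mu>"
    and fixpoint: "\<And>sa. Qs sa = bellman_op P r Qs sa - g"
    and inv: "savia_inv Q0 Qs \<mu> e k (Q, T, h)"
    and T: "sp (\<lambda>sa. T sa - bellman_op P r Q sa) \<le> e"
    and Q': "Q' = (\<lambda>sa. 2 / (real k + 3) * Q0 sa + (real k + 1) / (real k + 3) * T sa)"
    and D: "sp (\<lambda>sa. T' sa - T sa) \<le> sp (\<lambda>sa. Q' sa - Q sa)"
    and T': "sp (\<lambda>sa. T' sa - bellman_op P r Q' sa) \<le> e"
  shows "savia_inv Q0 Qs \<mu> e (Suc k) (Q', T', h')"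
proof -
  define K where "K = real k"
  have "0 \<le> K" by (simp add: K_def)
  then have [simp]: "K + 2 \<noteq> 0" "K + 3 \<noteq> 0" "K + 4 \<noteq> 0" "0 \<le> K + 1" "0 \<le> K + 3" "0 \<le> K + 4" "0 < K + 2" "0 < K + 3" "0 < K + 4"
    by auto
  have \<mu>0: "0 \<le> \<mu>" using sp_nonneg \<mu> by (rule order_trans)
  define w where "w = 4 * \<mu> / (K + 2) + e / 3"
  have a: "sp (\<lambda>sa. Q sa - Qs sa) \<le> \<mu> + e * K / 3" and w: "sp (\<lambda>sa. Q' sa - Q sa) \<le> w"
    using inv by (auto simp: savia_inv_def Q' K_def w_def)
  \<comment> \<open>One more residual turns \<open>e * K / 3\<close> into
    \<open>e * (K + 3) / 3\<close>, and the weight \<open>(K + 1) / (K + 3)\<close> then reduces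
    this to \<open>e * (K + 1) / 3\<close>. This is where the growth rate \<open>e / 3\<close> comes
    from.\<close>
  have TQs: "sp (\<lambda>sa. T sa - Qs sa) \<le> \<mu> + e * (K + 3) / 3"
    using sp_diff_anchor_le(1)[OF \<mu> fixpoint T] a by (simp add: field_simps)
  have "sp (\<lambda>sa. Q' sa - Qs sa)
      = sp (\<lambda>sa. 2 / (K + 3) * (Q0 sa - Qs sa) + (K + 1) / (K + 3) * (T sa - Qs sa))"
  proof (rule arg_cong[of _ _ sp], rule ext)
    fix sa
    have "Qs sa = 2 / (K + 3) * Qs sa + (K + 1) / (K + 3) * Qs sa"
      using \<open>0 \<le> K\<close> by (simp add: divide_simps) (simp add: algebra_simps)
    then show "Q' sa - Qs sa = 2 / (K + 3) * (Q0 sa - Qs sa) + (K + 1) / (K + 3) * (T sa - Qs sa)"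
      unfolding Q' K_def[symmetric] right_diff_distrib by linarith
  qed
  also have "\<dots> \<le> 2 / (K + 3) * sp (\<lambda>sa. Q0 sa - Qs sa) + (K + 1) / (K + 3) * sp (\<lambda>sa. T sa - Qs sa)"
    by (rule sp_comb) auto
  also have "\<dots> \<le> 2 / (K + 3) * \<mu> + (K + 1) / (K + 3) * (\<mu> + e * (K + 3) / 3)"
    by (intro add_mono mult_left_mono \<mu> TQs) auto
  also have "\<dots> = \<mu> + e * (K + 1) / 3"
    using \<open>0 \<le> K\<close> by (simp add: divide_simps) (simp add: algebra_simps)
  finally have a': "sp (\<lambda>sa. Q' sa - Qs sa) \<le> \<mu> + e * (K + 1) / 3" .
  have b: "sp (\<lambda>sa. T' sa - Q0 sa) \<le> 2 * \<mu> + e * (K + 4) / 3"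
    using sp_diff_anchor_le(2)[OF \<mu> fixpoint T'] a' by (simp add: field_simps)
  have D': "sp (\<lambda>sa. T' sa - T sa) \<le> w" using D w by linarith

  \<comment> \<open>The next increment is the change of weight, \<open>(K + 2) / (K + 4) - (K + 1) /
    (K + 3) = 2 / ((K + 3) * (K + 4))\<close>, times \<open>T' - Q0\<close>, plus the old weight
    times \<open>T' - T\<close>.\<close>
  have "sp (\<lambda>sa. (2 / (K + 4) * Q0 sa + (K + 2) / (K + 4) * T' sa) - Q' sa)
      = sp (\<lambda>sa. 2 / ((K + 3) * (K + 4)) * (T' sa - Q0 sa) + (K + 1) / (K + 3) * (T' sa - T sa))"
  proof (rule arg_cong[of _ _ sp], rule ext)
    fix sa
    have "2 / (K + 4) = 2 / (K + 3) - 2 / ((K + 3) * (K + 4))"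
      "(K + 2) / (K + 4) = 2 / ((K + 3) * (K + 4)) + (K + 1) / (K + 3)"
      using \<open>0 \<le> K\<close> by (simp_all add: divide_simps) (simp_all add: algebra_simps)
    \<comment> \<open>With the fractions replaced by unknowns obeying two linear relations, a
      polynomial identity remains.\<close>
    moreover have "p = q - u \<Longrightarrow> v = u + y \<Longrightarrow>
        p * Q0 sa + v * T' sa - (q * Q0 sa + y * T sa) = u * (T' sa - Q0 sa) + y * (T' sa - T sa)"
      for p q u v y
      by (simp only:) (simp add: algebra_simps)
    ultimately show "(2 / (K + 4) * Q0 sa + (K + 2) / (K + 4) * T' sa) - Q' sa
        = 2 / ((K + 3) * (K + 4)) * (T' sa - Q0 sa) + (K + 1) / (K + 3) * (T' sa - T sa)"
      unfolding Q' K_def[symmetric] by blast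
  qed
  also have "\<dots> \<le> 2 / ((K + 3) * (K + 4)) * sp (\<lambda>sa. T' sa - Q0 sa)
      + (K + 1) / (K + 3) * sp (\<lambda>sa. T' sa - T sa)"
    by (rule sp_comb) auto
  also have "\<dots> \<le> 2 / ((K + 3) * (K + 4)) * (2 * \<mu> + e * (K + 4) / 3) + (K + 1) / (K + 3) * w"
    by (intro add_mono mult_left_mono b D') auto
  \<comment> \<open>The error parts \<open>2 / (K + 3) * (e / 3)\<close> and
    \<open>(K + 1) / (K + 3) * (e / 3)\<close> add up to exactly \<open>e / 3\<close>, so the
    increment bound reproduces itself.\<close>
  also have "\<dots> = 4 * \<mu> / (K + 3) * (1 / (K + 4) + (K + 1) / (K + 2)) + e / 3"
    using \<open>0 \<le> K\<close> unfolding w_def by (simp add: divide_simps) (simp add: algebra_simps)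
  also have "\<dots> \<le> 4 * \<mu> / (K + 3) * 1 + e / 3"
  proof -
    have "1 / (K + 4) \<le> 1 / (K + 2)" using \<open>0 \<le> K\<close> by (intro divide_left_mono) auto
    moreover have "(K + 1) / (K + 2) = 1 - 1 / (K + 2)" by (simp add: field_simps)
    ultimately have "1 / (K + 4) + (K + 1) / (K + 2) \<le> 1" by linarith
    then show ?thesis using \<mu>0 by (intro add_right_mono mult_left_mono) auto
  qed
  finally have w': "sp (\<lambda>sa. (2 / (K + 4) * Q0 sa + (K + 2) / (K + 4) * T' sa) - Q' sa)
      \<le> 4 * \<mu> / (K + 3) + e / 3" by simp

  have "sp (\<lambda>sa. T' sa - Q' sa)
      = sp (\<lambda>sa. 2 / (K + 3) * (T' sa - Q0 sa) + (K + 1) / (K + 3) * (T' sa - T sa))"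
  proof (rule arg_cong[of _ _ sp], rule ext)
    fix sa
    have "T' sa = 2 / (K + 3) * T' sa + (K + 1) / (K + 3) * T' sa"
      using \<open>0 \<le> K\<close> by (simp add: divide_simps) (simp add: algebra_simps)
    then show "T' sa - Q' sa = 2 / (K + 3) * (T' sa - Q0 sa) + (K + 1) / (K + 3) * (T' sa - T sa)"
      unfolding Q' K_def[symmetric] right_diff_distrib by linarith
  qed
  also have "\<dots> \<le> 2 / (K + 3) * sp (\<lambda>sa. T' sa - Q0 sa)
      + (K + 1) / (K + 3) * sp (\<lambda>sa. T' sa - T sa)"
    by (rule sp_comb) auto
  also have "\<dots> \<le> 2 / (K + 3) * (2 * \<mu> + e * (K + 4) / 3) + (K + 1) / (K + 3) * w"
    by (intro add_mono mult_left_mono b D') auto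
  \<comment> \<open>Here the error parts carry the weights \<open>2 * (K + 4)\<close> and
    \<open>K + 1\<close> over \<open>3 * (K + 3)\<close>, with sum one.\<close>
  also have "\<dots> = 4 * \<mu> / (K + 3) * (1 + (K + 1) / (K + 2)) + e"
    using \<open>0 \<le> K\<close> unfolding w_def by (simp add: divide_simps) (simp add: algebra_simps)
  also have "\<dots> \<le> 4 * \<mu> / (K + 3) * 2 + e"
    using \<open>0 \<le> K\<close> \<mu>0 by (intro add_right_mono mult_left_mono) simp_all
  finally have c: "sp (\<lambda>sa. Q' sa - T' sa) \<le> 8 * \<mu> / (K + 3) + e"
    by (simp add: sp_diff_commute[of Q' T'])
  show ?thesis
    using a' b w' c by (simp add: savia_inv_def K_def add_ac)
qed


section \<open>Exponential moments and tails of the sampling error\<close>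

lemma Hoeffding_pmf:
  fixes f :: "'s::finite \<Rightarrow> real"
  shows "(\<integral>\<^sup>+ s. ennreal (exp (t * (f s - (\<Sum>s\<in>UNIV. pmf p s * f s)))) \<partial>measure_pmf p)
      \<le> ennreal (exp (t\<^sup>2 * (sp f)\<^sup>2 / 8))"
proof -
  have pos: "(\<integral>\<^sup>+ s. ennreal (exp (t * (f s - (\<Sum>s\<in>UNIV. pmf p s * f s)))) \<partial>measure_pmf p)
      \<le> ennreal (exp (t\<^sup>2 * (sp f)\<^sup>2 / 8))" if "t > 0" for t and f :: "'s \<Rightarrow> real"
  proof -
    interpret interval_bounded_random_variable "measure_pmf p" f "MIN s. f s" "MAX s. f s"
      by unfold_locales (auto intro!: Min_le Max_ge)
    have "measure_pmf.expectation p f = (\<Sum>s\<in>UNIV. pmf p s * f s)"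
      by (subst integral_measure_pmf_real[where A = UNIV]) (auto simp: mult_ac)
    then show ?thesis
      using Hoeffdings_lemma_nn_integral[OF \<open>t > 0\<close>] by (simp add: sp_def)
  qed
  \<comment> \<open>Negative \<open>t\<close> reduces to the positive case for \<open>- f\<close>,
    whose span is the same.\<close>
  consider "t > 0" | "t = 0" | "- t > 0" by linarith
  then show ?thesis
  proof cases
    case 3
    from pos[OF this, of "\<lambda>s. - f s"] show ?thesis
      by (simp add: sp_minus sum_negf algebra_simps)
  qed (use pos in auto)
qed

lemma nn_integral_exp_sum_replicate_pmf:
  "(\<integral>\<^sup>+ xs. ennreal (exp (\<Sum>j<m. g (xs ! j))) \<partial>measure_pmf (replicate_pmf m p))
    = (\<integral>\<^sup>+ x. ennreal (exp (g x)) \<partial>measure_pmf p) ^ m"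
proof (induction m)
  case (Suc m)
  then show ?case
    by (simp add: sum.lessThan_Suc_shift exp_add ennreal_mult nn_integral_cmult nn_integral_multc
        del: sum.lessThan_Suc)
qed simp

text \<open>One coordinate of the product law consists of \<open>m\<close> independent draws, so its
  transform is an \<open>m\<close>-th power. Each draw has parameter \<open>t / m\<close>, and
  \<open>m * (t / m)^2 = t^2 / m\<close>.\<close>

lemma SAMPLE_mgf:
  fixes P :: "'s::finite \<times> 'a::finite \<Rightarrow> 's pmf"
  assumes "1 \<le> m"
  shows "(\<integral>\<^sup>+ D. ennreal (exp (t * (D sa - (\<Sum>s\<in>UNIV. pmf (P sa) s * d s)))) \<partial>SAMPLE P d m)
      \<le> ennreal (exp (t\<^sup>2 * (sp d)\<^sup>2 / (8 * real m)))"
proof -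
  let ?e = "\<Sum>s\<in>UNIV. pmf (P sa) s * d s"
  have m: "real m > 0" using assms by simp
  have "(\<integral>\<^sup>+ D. ennreal (exp (t * (D sa - ?e))) \<partial>SAMPLE P d m)
      = (\<integral>\<^sup>+ X. ennreal (exp (\<Sum>j<m. t / real m * (d (X sa ! j) - ?e)))
          \<partial>Pi_pmf UNIV [] (\<lambda>sa. replicate_pmf m (P sa)))"
    unfolding SAMPLE_def nn_integral_map_pmf
    using m by (simp add: sum_subtractf right_diff_distrib sum_distrib_left sum_divide_distrib)
  also have "\<dots> = (\<integral>\<^sup>+ xs. ennreal (exp (\<Sum>j<m. t / real m * (d (xs ! j) - ?e)))
      \<partial>map_pmf (\<lambda>X. X sa) (Pi_pmf UNIV [] (\<lambda>sa. replicate_pmf m (P sa))))"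
    by simp
  also have "\<dots> = (\<integral>\<^sup>+ xs. ennreal (exp (\<Sum>j<m. t / real m * (d (xs ! j) - ?e)))
      \<partial>replicate_pmf m (P sa))"
    by (subst Pi_pmf_component) auto
  also have "\<dots> = (\<integral>\<^sup>+ s. ennreal (exp (t / real m * (d s - ?e))) \<partial>P sa) ^ m"
    by (rule nn_integral_exp_sum_replicate_pmf)
  also have "\<dots> \<le> ennreal (exp ((t / real m)\<^sup>2 * (sp d)\<^sup>2 / 8)) ^ m"
    by (intro power_mono Hoeffding_pmf) auto
  also have "\<dots> = ennreal (exp (real m * ((t / real m)\<^sup>2 * (sp d)\<^sup>2 / 8)))"
    by (subst ennreal_power, simp, subst exp_of_nat_mult, rule refl)
  also have "real m * ((t / real m)\<^sup>2 * (sp d)\<^sup>2 / 8) = t\<^sup>2 * (sp d)\<^sup>2 / (8 * real m)"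
    using m by (simp add: power2_eq_square)
  finally show ?thesis .
qed

text \<open>Along the iteration \<open>h\<close> is the telescoping sum of the \<open>d\<close>, so
  this is the noise \<open>D - P d\<close> accumulated over all steps so far. If
  \<open>h = maxA Q\<close>, it equals \<open>T - bellman_op P r Q\<close> at
  \<open>sa\<close>.\<close>

definition sampling_error ::
  "('s::finite \<times> 'a::finite \<Rightarrow> 's pmf) \<Rightarrow> ('s \<times> 'a \<Rightarrow> real) \<Rightarrow> 's \<times> 'a \<Rightarrow> ('s, 'a) savia_state \<Rightarrow> real"
where
  "sampling_error P r sa = (\<lambda>(Q, T, h). T sa - (r sa + (\<Sum>s\<in>UNIV. pmf (P sa) s * h s)))"

text \<open>Given \<open>T\<close> and \<open>h\<close> the sample size is fixed, and its choice
  yields \<open>(sp d)^2 / m \<le> \<epsilon>^2 / (\<alpha> * c k)\<close>. The resulting factor is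
  deterministic although the sample size depends on the past.\<close>

lemma savia_step_mgf:
  fixes P :: "'s::finite \<times> 'a::finite \<Rightarrow> 's pmf"
  assumes "\<alpha> > 0" "\<epsilon> > 0" "c k > 0"
  shows "(\<integral>\<^sup>+ st. ennreal (exp (t * sampling_error P r sa st)) \<partial>savia_step P c \<beta> Q0 \<alpha> \<epsilon> k T h)
      \<le> ennreal (exp (t\<^sup>2 * \<epsilon>\<^sup>2 / (8 * \<alpha>) * (1 / c k))) * ennreal (exp (t * sampling_error P r sa (Q, T, h)))"
proof -
  define Q' where "Q' = (\<lambda>sa. (1 - \<beta> k) * Q0 sa + \<beta> k * T sa)"
  define d where "d = (\<lambda>s. maxA Q' s - h s)"
  define m where "m = max (nat \<lceil>\<alpha> * c k * (sp d)\<^sup>2 / \<epsilon>\<^sup>2\<rceil>) 1"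
  let ?e = "\<Sum>s\<in>UNIV. pmf (P sa) s * d s"
  have step: "savia_step P c \<beta> Q0 \<alpha> \<epsilon> k T h = map_pmf (\<lambda>D. (Q', \<lambda>sa. T sa + D sa, maxA Q')) (SAMPLE P d m)"
    by (simp add: savia_step_def Let_def Q'_def d_def m_def)
  have m1: "1 \<le> m" and m: "\<alpha> * c k * (sp d)\<^sup>2 / \<epsilon>\<^sup>2 \<le> real m"
    unfolding m_def by linarith+
  \<comment> \<open>As \<open>maxA Q' = h + d\<close>, the step adds exactly the centred noise
    \<open>D sa - ?e\<close>.\<close>
  have err: "sampling_error P r sa (Q', \<lambda>sa. T sa + D sa, maxA Q')
      = (D sa - ?e) + sampling_error P r sa (Q, T, h)" for D
    by (simp add: sampling_error_def d_def right_diff_distrib sum_subtractf)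
  have "(\<integral>\<^sup>+ st. ennreal (exp (t * sampling_error P r sa st)) \<partial>savia_step P c \<beta> Q0 \<alpha> \<epsilon> k T h)
      = (\<integral>\<^sup>+ D. ennreal (exp (t * (D sa - ?e))) * ennreal (exp (t * sampling_error P r sa (Q, T, h)))
          \<partial>SAMPLE P d m)"
    unfolding step nn_integral_map_pmf err distrib_left exp_add by (simp add: ennreal_mult)
  also have "\<dots> = (\<integral>\<^sup>+ D. ennreal (exp (t * (D sa - ?e))) \<partial>SAMPLE P d m)
      * ennreal (exp (t * sampling_error P r sa (Q, T, h)))"
    by (simp add: nn_integral_multc)
  also have "\<dots> \<le> ennreal (exp (t\<^sup>2 * (sp d)\<^sup>2 / (8 * real m)))
      * ennreal (exp (t * sampling_error P r sa (Q, T, h)))"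
    by (intro mult_right_mono SAMPLE_mgf m1) auto
  also have "t\<^sup>2 * (sp d)\<^sup>2 / (8 * real m) \<le> t\<^sup>2 * \<epsilon>\<^sup>2 / (8 * \<alpha>) * (1 / c k)"
  proof -
    have "\<alpha> * c k * (sp d)\<^sup>2 \<le> \<epsilon>\<^sup>2 * real m"
      using m assms by (simp add: divide_simps mult_ac)
    then have "(sp d)\<^sup>2 / real m \<le> \<epsilon>\<^sup>2 / (\<alpha> * c k)"
      using assms m1 by (simp add: field_simps)
    then have "t\<^sup>2 / 8 * ((sp d)\<^sup>2 / real m) \<le> t\<^sup>2 / 8 * (\<epsilon>\<^sup>2 / (\<alpha> * c k))"
      by (intro mult_left_mono) auto
    then show ?thesis by (simp add: mult_ac)
  qed
  finally show ?thesis
    by (simp add: mult_right_mono)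
qed

text \<open>Conditioning on the previous state peels off one deterministic factor per step, and the
  exponents add up.\<close>

lemma savia_iter_mgf:
  fixes P :: "'s::finite \<times> 'a::finite \<Rightarrow> 's pmf"
  assumes "\<alpha> > 0" "\<epsilon> > 0" "\<And>k. c k > 0"
  shows "(\<integral>\<^sup>+ st. ennreal (exp (t * sampling_error P r sa st)) \<partial>savia_iter P r c \<beta> Q0 \<alpha> \<epsilon> k)
      \<le> ennreal (exp (t\<^sup>2 * \<epsilon>\<^sup>2 / (8 * \<alpha>) * (\<Sum>i\<le>k. 1 / c i)))"
proof (induction k)
  case 0
  \<comment> \<open>The initial values \<open>T = r\<close> and \<open>h = 0\<close> carry no
    error.\<close>
  have "sampling_error P r sa (Q0, r, \<lambda>_. 0) = 0"
    by (simp add: sampling_error_def)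
  then show ?case
    using savia_step_mgf[where k = 0 and c = c and T = r and h = "\<lambda>_. 0" and Q = Q0
      and P = P and r = r and sa = sa and t = t and \<beta> = \<beta> and ?Q0.0 = Q0, OF assms] by simp
next
  case (Suc k)
  let ?B = "\<lambda>S. ennreal (exp (t\<^sup>2 * \<epsilon>\<^sup>2 / (8 * \<alpha>) * S))"
  have "(\<integral>\<^sup>+ st. ennreal (exp (t * sampling_error P r sa st)) \<partial>savia_iter P r c \<beta> Q0 \<alpha> \<epsilon> (Suc k))
      \<le> (\<integral>\<^sup>+ st. ?B (1 / c (Suc k)) * ennreal (exp (t * sampling_error P r sa st))
          \<partial>savia_iter P r c \<beta> Q0 \<alpha> \<epsilon> k)"
    unfolding savia_iter.simps nn_integral_bind_pmf
  proof (rule nn_integral_mono)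
    fix st :: "('s, 'a) savia_state"
    obtain Q T h where st: "st = (Q, T, h)" by (cases st)
    show "(\<integral>\<^sup>+ st'. ennreal (exp (t * sampling_error P r sa st'))
        \<partial>(case st of (Q, T, h) \<Rightarrow> savia_step P c \<beta> Q0 \<alpha> \<epsilon> (Suc k) T h))
        \<le> ?B (1 / c (Suc k)) * ennreal (exp (t * sampling_error P r sa st))"
      unfolding st prod.case by (rule savia_step_mgf) (rule assms)+
  qed
  also have "\<dots> = ?B (1 / c (Suc k)) *
      (\<integral>\<^sup>+ st. ennreal (exp (t * sampling_error P r sa st)) \<partial>savia_iter P r c \<beta> Q0 \<alpha> \<epsilon> k)"
    by (simp add: nn_integral_cmult)
  also have "\<dots> \<le> ?B (1 / c (Suc k)) * ?B (\<Sum>i\<le>k. 1 / c i)"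
    by (intro mult_left_mono Suc.IH) auto
  also have "\<dots> = ?B (\<Sum>i\<le>Suc k. 1 / c i)"
    unfolding sum.atMost_Suc distrib_left exp_add
    by (simp only: ennreal_mult[OF exp_ge_zero exp_ge_zero] mult.commute)
  finally show ?case .
qed

lemma savia_iter_tail:
  fixes P :: "'s::finite \<times> 'a::finite \<Rightarrow> 's pmf"
  assumes "\<alpha> > 0" "\<epsilon> > 0" "\<And>k. c k > 0" and S: "(\<Sum>i\<le>k. 1 / c i) \<le> 2"
  shows "measure_pmf.prob (savia_iter P r c \<beta> Q0 \<alpha> \<epsilon> k) {st. \<epsilon> < \<bar>sampling_error P r sa st\<bar>}
      \<le> 2 * exp (- \<alpha>)"
proof -
  let ?M = "savia_iter P r c \<beta> Q0 \<alpha> \<epsilon> k"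
  \<comment> \<open>Minimiser of the Chernoff exponent
    \<open>- t * \<epsilon> + t^2 * \<epsilon>^2 / (4 * \<alpha>)\<close>, obtained from the bound 2
    on the sum; the minimum is \<open>- \<alpha>\<close>.\<close>
  let ?t = "2 * \<alpha> / \<epsilon>"
  \<comment> \<open>The sign \<sigma> treats both tails at once, since the moment bound sees only
    the square of the parameter.\<close>
  have one_sided: "measure_pmf.prob ?M {st. \<epsilon> < \<sigma> * sampling_error P r sa st} \<le> exp (- \<alpha>)"
    if \<sigma>: "\<sigma>\<^sup>2 = 1" for \<sigma> :: real
  proof -
    have "emeasure ?M {st. \<epsilon> < \<sigma> * sampling_error P r sa st}
        = (\<integral>\<^sup>+ st. indicator {st. \<epsilon> < \<sigma> * sampling_error P r sa st} st \<partial>?M)"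
      by simp
    also have "\<dots> \<le> (\<integral>\<^sup>+ st. ennreal (exp (- (2 * \<alpha>))) * ennreal (exp ((\<sigma> * ?t) * sampling_error P r sa st)) \<partial>?M)"
    proof (rule nn_integral_mono)
      fix st
      show "indicator {st. \<epsilon> < \<sigma> * sampling_error P r sa st} st
          \<le> ennreal (exp (- (2 * \<alpha>))) * ennreal (exp ((\<sigma> * ?t) * sampling_error P r sa st))"
      proof (cases "\<epsilon> < \<sigma> * sampling_error P r sa st")
        case True
        then have "?t * \<epsilon> \<le> ?t * (\<sigma> * sampling_error P r sa st)"
          using assms by (intro mult_left_mono) auto
        then have "0 \<le> - (2 * \<alpha>) + (\<sigma> * ?t) * sampling_error P r sa st"
          using \<open>\<epsilon> > 0\<close> by (simp add: mult_ac)
        then have "1 \<le> exp (- (2 * \<alpha>)) * exp ((\<sigma> * ?t) * sampling_error P r sa st)"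
          unfolding exp_add[symmetric] by (subst one_le_exp_iff)
        then show ?thesis using True by (simp flip: ennreal_mult)
      qed simp
    qed
    also have "\<dots> = ennreal (exp (- (2 * \<alpha>))) *
        (\<integral>\<^sup>+ st. ennreal (exp ((\<sigma> * ?t) * sampling_error P r sa st)) \<partial>?M)"
      by (rule nn_integral_cmult) simp
    also have "\<dots> \<le> ennreal (exp (- (2 * \<alpha>))) *
        ennreal (exp ((\<sigma> * ?t)\<^sup>2 * \<epsilon>\<^sup>2 / (8 * \<alpha>) * (\<Sum>i\<le>k. 1 / c i)))"
      by (intro mult_left_mono savia_iter_mgf assms) auto
    also have "\<dots> = ennreal (exp (- (2 * \<alpha>) + (\<sigma> * ?t)\<^sup>2 * \<epsilon>\<^sup>2 / (8 * \<alpha>) * (\<Sum>i\<le>k. 1 / c i)))"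
      by (subst exp_add, subst ennreal_mult) auto
    also have "(\<sigma> * ?t)\<^sup>2 * \<epsilon>\<^sup>2 / (8 * \<alpha>) = \<alpha> / 2"
      using assms \<sigma> by (simp add: power_mult_distrib power_divide) (simp add: power2_eq_square)
    also have "ennreal (exp (- (2 * \<alpha>) + \<alpha> / 2 * (\<Sum>i\<le>k. 1 / c i))) \<le> ennreal (exp (- \<alpha>))"
    proof -
      have "\<alpha> / 2 * (\<Sum>i\<le>k. 1 / c i) \<le> \<alpha> / 2 * 2"
        using S \<open>\<alpha> > 0\<close> by (intro mult_left_mono) auto
      then show ?thesis by (intro ennreal_leI) simp
    qed
    finally show ?thesis
      by (simp add: measure_pmf.emeasure_eq_measure)
  qed
  have "measure_pmf.prob ?M {st. \<epsilon> < \<bar>sampling_error P r sa st\<bar>}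
      \<le> measure_pmf.prob ?M ({st. \<epsilon> < 1 * sampling_error P r sa st} \<union> {st. \<epsilon> < (- 1) * sampling_error P r sa st})"
    by (intro measure_pmf.finite_measure_mono) (auto simp: abs_real_def split: if_splits)
  also have "\<dots> \<le> exp (- \<alpha>) + exp (- \<alpha>)"
    by (rule order_trans[OF measure_Un_le add_mono[OF one_sided one_sided]]) auto
  finally show ?thesis by simp
qed

text \<open>Discrete form of the fact that \<open>1 / (x * (ln x)^2)\<close> has the primitive
  \<open>- 1 / ln x\<close>: the terms are dominated by a telescoping series.\<close>

lemma sum_inverse_c_le:
  fixes c :: "nat \<Rightarrow> real"
  assumes "\<And>k. c k = 5 * (real k + 2) * (ln (real k + 2))\<^sup>2"
  shows "(\<Sum>i\<le>k. 1 / c i) \<le> 2"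
proof -
  have l2: "2 / 3 \<le> ln (2::real)" by (rule ln2_ge_two_thirds)
  \<comment> \<open>The term of index 0 stays apart because its telescoping bound would contain
    \<open>1 / ln 1\<close>.\<close>
  have "(\<Sum>i\<le>k. 1 / c i) \<le> 1 / c 0 + (1 / ln 2 - 1 / ln (real k + 2)) / 5"
  proof (induction k)
    case (Suc k)
    define x where "x = real k + 2"
    have x: "x \<ge> 2" by (simp add: x_def)
    have lx: "0 < ln x" "0 < ln (x + 1)" "ln x \<le> ln (x + 1)" using x by auto
    have "ln (x / (x + 1)) \<le> x / (x + 1) - 1"
      using x by (intro ln_le_minus_one) auto
    then have *: "1 / (x + 1) \<le> ln (x + 1) - ln x"
      using x by (simp add: ln_div field_simps)
    have "1 / ((x + 1) * (ln (x + 1))\<^sup>2) = (1 / (x + 1)) / (ln (x + 1) * ln (x + 1))"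
      by (simp add: power2_eq_square)
    also have "\<dots> \<le> (ln (x + 1) - ln x) / (ln x * ln (x + 1))"
      using x lx * by (intro frac_le mult_mono) auto
    also have "\<dots> = 1 / ln x - 1 / ln (x + 1)"
      using lx by (simp add: field_simps)
    finally have **: "1 / ((x + 1) * (ln (x + 1))\<^sup>2) \<le> 1 / ln x - 1 / ln (x + 1)" .
    have "c (Suc k) = 5 * ((x + 1) * (ln (x + 1))\<^sup>2)"
      by (simp add: assms x_def add_ac)
    then have "1 / c (Suc k) \<le> (1 / ln x - 1 / ln (x + 1)) / 5"
      using ** by simp
    with Suc show ?case by (simp add: x_def add_ac diff_divide_distrib)
  qed simp
  also have "\<dots> \<le> 1 / c 0 + 1 / ln 2 / 5"
  proof -
    have "0 \<le> 1 / ln (real k + 2)" by simp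
    then show ?thesis by simp
  qed
  also have "\<dots> \<le> 1 + 1"
  proof (rule add_mono)
    have "(2 / 3)\<^sup>2 \<le> (ln (2::real))\<^sup>2" using l2 by (intro power_mono) auto
    then show "1 / c 0 \<le> 1" unfolding assms by (simp add: power2_eq_square field_simps)
    show "1 / ln 2 / 5 \<le> (1::real)" using l2 by (simp add: field_simps)
  qed
  finally show ?thesis by simp
qed


section \<open>The good event and the failure probability of one run\<close>

text \<open>The law of the iteration records only the current state, so the smallness of all earlier
  errors is carried by its consequence \<open>savia_inv\<close>. The equation for \<open>h\<close>
  identifies the sampling error with the Bellman error.\<close>

definition savia_good ::
  "('s::finite \<times> 'a::finite \<Rightarrow> 's pmf) \<Rightarrow> ('s \<times> 'a \<Rightarrow> real) \<Rightarrow> ('s \<times> 'a \<Rightarrow> real) \<Rightarrow> ('s \<times> 'a \<Rightarrow> real) \<Rightarrow>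
   real \<Rightarrow> real \<Rightarrow> nat \<Rightarrow> ('s, 'a) savia_state \<Rightarrow> bool" where
  "savia_good P r Q0 Qs \<mu> \<epsilon> k st \<longleftrightarrow>
     savia_inv Q0 Qs \<mu> (2 * \<epsilon>) k st \<and> snd (snd st) = maxA (fst st) \<and>
     (\<forall>sa. \<bar>sampling_error P r sa st\<bar> \<le> \<epsilon>)"

lemma sp_sampling_error_le:
  assumes "\<forall>sa. \<bar>sampling_error P r sa (Q, T, maxA Q)\<bar> \<le> \<epsilon>"
  shows "sp (\<lambda>sa. T sa - bellman_op P r Q sa) \<le> 2 * \<epsilon>"
proof (rule sp_le_abs)
  fix sa
  show "\<bar>T sa - bellman_op P r Q sa\<bar> \<le> \<epsilon>"
    using assms[rule_format, of sa] by (simp add: sampling_error_def bellman_op_def)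
qed

lemma savia_good_0:
  fixes P :: "'s::finite \<times> 'a::finite \<Rightarrow> 's pmf"
  assumes \<mu>: "sp (\<lambda>sa. Q0 sa - Qs sa) \<le> \<mu>"
    and fixpoint: "\<And>sa. Qs sa = bellman_op P r Qs sa - g"
    and \<beta>: "\<And>k. \<beta> k = real k / (real k + 2)"
    and st: "st \<in> set_pmf (savia_step P c \<beta> Q0 \<alpha> \<epsilon> 0 T h)"
    and err: "\<forall>sa. \<bar>sampling_error P r sa st\<bar> \<le> \<epsilon>"
  shows "savia_good P r Q0 Qs \<mu> \<epsilon> 0 st"
proof -
  \<comment> \<open>Since \<open>\<beta> 0 = 0\<close>, the first iterate is the anchor
    \<open>Q0\<close>.\<close>
  obtain T' where st': "st = (Q0, T', maxA Q0)"
    using st by (auto simp: savia_step_def Let_def \<beta>)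
  show ?thesis
    using err savia_inv_0[OF \<mu> fixpoint sp_sampling_error_le] by (simp add: savia_good_def st')
qed

lemma savia_good_Suc:
  fixes P :: "'s::finite \<times> 'a::finite \<Rightarrow> 's pmf"
  assumes \<mu>: "sp (\<lambda>sa. Q0 sa - Qs sa) \<le> \<mu>"
    and fixpoint: "\<And>sa. Qs sa = bellman_op P r Qs sa - g"
    and \<beta>: "\<And>k. \<beta> k = real k / (real k + 2)"
    and good: "savia_good P r Q0 Qs \<mu> \<epsilon> k (Q, T, h)"
    and st: "st \<in> set_pmf (savia_step P c \<beta> Q0 \<alpha> \<epsilon> (Suc k) T h)"
    and err: "\<forall>sa. \<bar>sampling_error P r sa st\<bar> \<le> \<epsilon>"
  shows "savia_good P r Q0 Qs \<mu> \<epsilon> (Suc k) st"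
proof -
  define Q' where "Q' = (\<lambda>sa. 2 / (real k + 3) * Q0 sa + (real k + 1) / (real k + 3) * T sa)"
  have h: "h = maxA Q" using good by (simp add: savia_good_def)
  have \<beta>': "\<beta> (Suc k) = (real k + 1) / (real k + 3)"
    "1 - (real k + 1) / (real k + 3) = 2 / (real k + 3)"
    by (simp_all add: \<beta> field_simps)
  define d where "d = (\<lambda>s. maxA Q' s - maxA Q s)"
  define m where "m = max (nat \<lceil>\<alpha> * c (Suc k) * (sp d)\<^sup>2 / \<epsilon>\<^sup>2\<rceil>) 1"
  obtain D where D: "D \<in> set_pmf (SAMPLE P d m)"
    and st': "st = (Q', \<lambda>sa. T sa + D sa, maxA Q')"
    using st unfolding savia_step_def Let_def \<beta>' h Q'_def[symmetric] d_def[symmetric] m_def[symmetric]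
      set_map_pmf
    by blast
  have "1 \<le> m" by (simp add: m_def)
  have "savia_inv Q0 Qs \<mu> (2 * \<epsilon>) (Suc k) (Q', \<lambda>sa. T sa + D sa, maxA Q')"
  proof (rule savia_inv_Suc[OF \<mu> fixpoint])
    show "savia_inv Q0 Qs \<mu> (2 * \<epsilon>) k (Q, T, h)"
      using good unfolding savia_good_def by blast
    show "sp (\<lambda>sa. T sa - bellman_op P r Q sa) \<le> 2 * \<epsilon>"
      using good by (intro sp_sampling_error_le) (simp add: savia_good_def h)
    show "sp (\<lambda>sa. T sa + D sa - bellman_op P r Q' sa) \<le> 2 * \<epsilon>"
      using err by (intro sp_sampling_error_le) (simp add: st')
    show "sp (\<lambda>sa. T sa + D sa - T sa) \<le> sp (\<lambda>sa. Q' sa - Q sa)"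
      using sp_SAMPLE[OF D \<open>1 \<le> m\<close>] sp_maxA[of Q' Q] by (simp add: d_def)
  qed (fact Q'_def)
  then show ?thesis using err by (simp add: savia_good_def st')
qed

text \<open>Union bound along the iteration in terms of the laws at single steps: a state can be bad
  only if its predecessor was bad or its own sampling error is large.\<close>

lemma savia_iter_not_good_le:
  fixes P :: "'s::finite \<times> 'a::finite \<Rightarrow> 's pmf"
  assumes \<mu>: "sp (\<lambda>sa. Q0 sa - Qs sa) \<le> \<mu>"
    and fixpoint: "\<And>sa. Qs sa = bellman_op P r Qs sa - g"
    and \<beta>: "\<And>k. \<beta> k = real k / (real k + 2)"
  shows "emeasure (savia_iter P r c \<beta> Q0 \<alpha> \<epsilon> n) {st. \<not> savia_good P r Q0 Qs \<mu> \<epsilon> n st}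
      \<le> (\<Sum>k\<le>n. emeasure (savia_iter P r c \<beta> Q0 \<alpha> \<epsilon> k) {st. \<not> (\<forall>sa. \<bar>sampling_error P r sa st\<bar> \<le> \<epsilon>)})"
proof (induction n)
  case 0
  have "emeasure (savia_step P c \<beta> Q0 \<alpha> \<epsilon> 0 r (\<lambda>_. 0)) {st. \<not> savia_good P r Q0 Qs \<mu> \<epsilon> 0 st}
      \<le> emeasure (savia_step P c \<beta> Q0 \<alpha> \<epsilon> 0 r (\<lambda>_. 0))
          {st. \<not> (\<forall>sa. \<bar>sampling_error P r sa st\<bar> \<le> \<epsilon>)}"
    using savia_good_0[OF assms, where c = c and \<alpha> = \<alpha> and \<epsilon> = \<epsilon> and T = r and h = "\<lambda>_. 0"]
    by (intro emeasure_mono_AE) (unfold AE_measure_pmf_iff mem_Collect_eq, blast, simp)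
  then show ?case by simp
next
  case (Suc n)
  let ?B = "{st. \<not> (\<forall>sa. \<bar>sampling_error P r sa st\<bar> \<le> \<epsilon>)}"
  let ?bad = "\<lambda>k. {st. \<not> savia_good P r Q0 Qs \<mu> \<epsilon> k st}"
  let ?N = "\<lambda>(Q, T, h). savia_step P c \<beta> Q0 \<alpha> \<epsilon> (Suc n) T h"
  let ?M = "savia_iter P r c \<beta> Q0 \<alpha> \<epsilon> n"
  have step: "emeasure (?N st) (?bad (Suc n)) \<le> indicator (?bad n) st + emeasure (?N st) ?B" for st
  proof (cases "savia_good P r Q0 Qs \<mu> \<epsilon> n st")
    case True
    obtain Q T h where st: "st = (Q, T, h)" by (cases st)
    have "emeasure (?N st) (?bad (Suc n)) \<le> emeasure (?N st) ?B"
      unfolding st prod.case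
      using savia_good_Suc[OF assms True[unfolded st], where c = c and \<alpha> = \<alpha>]
      by (intro emeasure_mono_AE) (unfold AE_measure_pmf_iff mem_Collect_eq, blast, simp)
    then show ?thesis using True by simp
  next
    case False
    have "emeasure (?N st) (?bad (Suc n)) \<le> 1" by (rule measure_pmf.emeasure_le_1)
    then show ?thesis using False by (simp add: add_increasing2)
  qed
  have "emeasure (savia_iter P r c \<beta> Q0 \<alpha> \<epsilon> (Suc n)) (?bad (Suc n))
      \<le> (\<integral>\<^sup>+ st. indicator (?bad n) st + emeasure (?N st) ?B \<partial>?M)"
    unfolding savia_iter.simps emeasure_bind_pmf by (intro nn_integral_mono step)
  also have "\<dots> = emeasure ?M (?bad n) + emeasure (savia_iter P r c \<beta> Q0 \<alpha> \<epsilon> (Suc n)) ?B"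
    by (simp add: nn_integral_add)
  also note add_right_mono[OF Suc.IH]
  finally show ?case by (simp only: sum.atMost_Suc)
qed

text \<open>Union bound over the \<open>n + 1\<close> steps and all state-action pairs, the factor 2
  accounting for the two tails.\<close>

lemma savia_iter_good:
  fixes P :: "'s::finite \<times> 'a::finite \<Rightarrow> 's pmf"
  assumes \<mu>: "sp (\<lambda>sa. Q0 sa - Qs sa) \<le> \<mu>"
    and fixpoint: "\<And>sa. Qs sa = bellman_op P r Qs sa - g"
    and \<beta>: "\<And>k. \<beta> k = real k / (real k + 2)"
    and c: "\<And>k. c k > 0" "\<And>k. (\<Sum>i\<le>k. 1 / c i) \<le> 2"
    and \<epsilon>: "\<epsilon> > 0" and \<alpha>: "\<alpha> > 0"
  shows "measure_pmf.prob (savia_iter P r c \<beta> Q0 \<alpha> \<epsilon> n) {st. \<not> savia_good P r Q0 Qs \<mu> \<epsilon> n st}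
      \<le> 2 * real CARD('s) * real CARD('a) * (real n + 1) * exp (- \<alpha>)"
proof -
  let ?M = "\<lambda>k. savia_iter P r c \<beta> Q0 \<alpha> \<epsilon> k"
  have "measure_pmf.prob (?M k) {st. \<not> (\<forall>sa. \<bar>sampling_error P r sa st\<bar> \<le> \<epsilon>)}
      \<le> 2 * real CARD('s) * real CARD('a) * exp (- \<alpha>)" for k
  proof -
    have "{st. \<not> (\<forall>sa. \<bar>sampling_error P r sa st\<bar> \<le> \<epsilon>)} = (\<Union>sa. {st. \<epsilon> < \<bar>sampling_error P r sa st\<bar>})"
      by (auto simp: not_le)
    then have "measure_pmf.prob (?M k) {st. \<not> (\<forall>sa. \<bar>sampling_error P r sa st\<bar> \<le> \<epsilon>)}
        \<le> (\<Sum>sa\<in>UNIV. measure_pmf.prob (?M k) {st. \<epsilon> < \<bar>sampling_error P r sa st\<bar>})"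
      by (simp add: measure_UNION_le)
    also have "\<dots> \<le> (\<Sum>sa\<in>(UNIV :: ('s \<times> 'a) set). 2 * exp (- \<alpha>))"
      by (intro sum_mono savia_iter_tail \<alpha> \<epsilon> c)
    also have "\<dots> = 2 * real CARD('s) * real CARD('a) * exp (- \<alpha>)"
      by simp
    finally show ?thesis .
  qed
  then have "(\<Sum>k\<le>n. measure_pmf.prob (?M k) {st. \<not> (\<forall>sa. \<bar>sampling_error P r sa st\<bar> \<le> \<epsilon>)})
      \<le> (\<Sum>k\<le>n. 2 * real CARD('s) * real CARD('a) * exp (- \<alpha>))"
    by (intro sum_mono)
  also have "\<dots> = 2 * real CARD('s) * real CARD('a) * (real n + 1) * exp (- \<alpha>)"
    by (simp add: mult_ac add_ac)
  finally show ?thesis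
    using savia_iter_not_good_le[OF \<mu> fixpoint \<beta>, where c = c and \<alpha> = \<alpha> and \<epsilon> = \<epsilon> and n = n]
    by (simp add: measure_pmf.emeasure_eq_measure sum_nonneg)
qed

lemma SAVIA_stop_criterion:
  fixes P :: "'s::finite \<times> 'a::finite \<Rightarrow> 's pmf"
  assumes fixpoint: "\<And>sa. Qs sa = bellman_op P r Qs sa - g"
    and \<beta>: "\<And>k. \<beta> k = real k / (real k + 2)"
    and c: "\<And>k. c k > 0" "\<And>k. (\<Sum>i\<le>k. 1 / c i) \<le> 2"
    and \<epsilon>: "\<epsilon> > 0" and \<delta>: "0 < \<delta>" "\<delta> < 1"
    and n: "sp (\<lambda>sa. Q0 sa - Qs sa) \<le> real n * \<epsilon>"
  shows "measure_pmf.prob (SAVIA P r c \<beta> greedy Q0 n \<epsilon> \<delta>) {x. \<not> stop_criterion \<epsilon> x} \<le> \<delta>"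
proof -
  define N where "N = 2 * real CARD('s) * real CARD('a) * (real n + 1)"
  define \<alpha> where "\<alpha> = ln (N / \<delta>)"
  let ?\<mu> = "sp (\<lambda>sa. Q0 sa - Qs sa)"
  have "1 * 1 * 1 \<le> real CARD('s) * real CARD('a) * (real n + 1)"
    by (intro mult_mono) (auto simp: Suc_le_eq)
  then have N: "1 \<le> N" by (simp add: N_def)
  then have \<alpha>: "\<alpha> > 0" using \<delta> by (simp add: \<alpha>_def)
  have stop: "stop_criterion \<epsilon> (Q, T, greedy Q)" if "savia_good P r Q0 Qs ?\<mu> \<epsilon> n (Q, T, h)" for Q T h
  proof -
    have "sp (\<lambda>sa. Q sa - T sa) \<le> 8 * ?\<mu> / (real n + 2) + 2 * \<epsilon>"
      using that by (simp add: savia_good_def savia_inv_def)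
    \<comment> \<open>This leaves \<open>8 * \<epsilon> + 2 * \<epsilon>\<close>, within the
      threshold \<open>14 * \<epsilon>\<close>.\<close>
    also have "?\<mu> \<le> (real n + 2) * \<epsilon>"
      using n \<epsilon> by (simp add: algebra_simps)
    then have "8 * ?\<mu> / (real n + 2) \<le> 8 * \<epsilon>" by (simp add: field_simps)
    finally show ?thesis using \<epsilon> by (simp add: stop_criterion_def)
  qed
  have "measure_pmf.prob (SAVIA P r c \<beta> greedy Q0 n \<epsilon> \<delta>) {x. \<not> stop_criterion \<epsilon> x}
      = measure_pmf.prob (savia_iter P r c \<beta> Q0 \<alpha> \<epsilon> n) {(Q, T, h). \<not> stop_criterion \<epsilon> (Q, T, greedy Q)}"
    by (simp add: SAVIA_def \<alpha>_def N_def vimage_def case_prod_unfold)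
  also have "\<dots> \<le> measure_pmf.prob (savia_iter P r c \<beta> Q0 \<alpha> \<epsilon> n)
      {st. \<not> savia_good P r Q0 Qs ?\<mu> \<epsilon> n st}"
    using stop by (intro measure_pmf.finite_measure_mono) auto
  also have "\<dots> \<le> N * exp (- \<alpha>)"
    using savia_iter_good[OF order_refl fixpoint \<beta> c \<epsilon> \<alpha>] by (simp add: N_def)
  \<comment> \<open>The logarithm defining \<alpha> is chosen to cancel the union bound.\<close>
  also have "\<dots> = \<delta>"
    using N \<delta> by (simp add: \<alpha>_def exp_minus)
  finally show ?thesis .
qed


section \<open>Expected horizon of the first successful loop under doubling\<close>

lemma one_plus_sum_powers_of_2: "1 + (\<Sum>k<m. 2 ^ k) = (2 ^ m :: 'a::comm_semiring_1)"
  by (induction m) (simp_all add: add.assoc[symmetric] mult_2)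

text \<open>
  If loops \<open>i\<^sub>0, \<dots>, i\<^sub>0 + m - 1\<close> fail and loop \<open>i\<^sub>0 + m\<close> succeeds, the horizon \<open>2 ^ (i\<^sub>0 + m)\<close> equals
  \<open>2 ^ i\<^sub>0 * (1 + (\<Sum>k<m. 2 ^ k))\<close>; the expectation thus reduces to the probabilities that all of
  the loops \<open>i\<^sub>0, \<dots>, i\<^sub>0 + k\<close> fail.
\<close>

lemma nn_integral_first_success_le:
  fixes M :: "nat \<Rightarrow> 'a pmf" and N :: "(nat \<Rightarrow> 'a) \<Rightarrow> enat"
  assumes N: "\<And>\<omega>. N \<omega> = (if \<exists>i. success (\<omega> i) then enat (2 ^ (LEAST i. success (\<omega> i))) else \<infinity>)"
    and fail: "\<And>i. i \<ge> i0 \<Longrightarrow> measure_pmf.prob (M i) {x. \<not> success x} \<le> q"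
    and q: "0 \<le> q" "2 * q < 1"
  shows "(\<integral>\<^sup>+ \<omega>. ennreal_of_enat (N \<omega>) \<partial>(\<Pi>\<^sub>M i\<in>UNIV. measure_pmf (M i)))
      \<le> ennreal (2 ^ i0 * (1 + q / (1 - 2 * q)))"
proof -
  interpret product_prob_space "\<lambda>i. measure_pmf (M i)" UNIV
    by unfold_locales
  let ?P = "\<Pi>\<^sub>M i\<in>UNIV. measure_pmf (M i)"
  define A where "A k = {\<omega>. \<forall>j\<in>{i0..i0 + k}. \<omega> j \<in> {x. \<not> success x}}" for k
  \<comment> \<open>Pointwise majorant of \<open>N\<close>: the loops before \<open>i0\<close> are
    charged \<open>2 ^ i0\<close> whatever their outcome, and each further failure charges its share
    of the doubling.\<close>
  define R :: "(nat \<Rightarrow> 'a) \<Rightarrow> ennreal" where "R \<omega> = 2 ^ i0 * (1 + (\<Sum>k. 2 ^ k * indicator (A k) \<omega>))" for \<omega>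
  have space: "space ?P = UNIV" by (simp add: space_PiM)
  have A_sets [measurable]: "A k \<in> sets ?P" for k
  proof -
    have "(\<lambda>\<omega>. \<omega> j) -` {x. \<not> success x} \<inter> space ?P \<in> sets ?P" for j
      by (rule measurable_sets[OF measurable_component_singleton]) auto
    then have "(\<Inter>j\<in>{i0..i0 + k}. (\<lambda>\<omega>. \<omega> j) -` {x. \<not> success x} \<inter> space ?P) \<in> sets ?P"
      by (intro sets.finite_INT) auto
    also have "(\<Inter>j\<in>{i0..i0 + k}. (\<lambda>\<omega>. \<omega> j) -` {x. \<not> success x} \<inter> space ?P) = A k"
      by (auto simp: A_def space)
    finally show ?thesis .
  qed
  have R_ge: "2 ^ (i0 + m) \<le> R \<omega>" if "\<And>k. k < m \<Longrightarrow> \<omega> \<in> A k" for \<omega> m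
  proof -
    have "(2::ennreal) ^ (i0 + m) = 2 ^ i0 * (1 + (\<Sum>k<m. 2 ^ k * indicator (A k) \<omega>))"
      using that by (simp add: power_add one_plus_sum_powers_of_2)
    also have "\<dots> \<le> R \<omega>"
      unfolding R_def by (intro mult_left_mono add_left_mono sum_le_suminf) auto
    finally show ?thesis .
  qed
  have "ennreal_of_enat (N \<omega>) \<le> R \<omega>" for \<omega>
  proof (cases "\<exists>i. success (\<omega> i)")
    case True
    define L where "L = (LEAST i. success (\<omega> i))"
    have "\<not> success (\<omega> j)" if "j < L" for j
      using that not_less_Least unfolding L_def by blast
    \<comment> \<open>Truncated subtraction also covers \<open>L < i0\<close>, where
      \<open>R\<close> is still at least \<open>2 ^ i0\<close>.\<close>
    then have "2 ^ (i0 + (L - i0)) \<le> R \<omega>"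
      by (intro R_ge) (auto simp: A_def)
    moreover have "(2::ennreal) ^ L \<le> 2 ^ (i0 + (L - i0))"
      by (intro power_increasing) auto
    ultimately show ?thesis
      using True by (simp add: N L_def[symmetric])
  next
    case False
    \<comment> \<open>If no loop succeeds, every \<open>A k\<close> occurs and the series diverges,
      matching \<open>N = \<infinity>\<close>.\<close>
    have "of_nat m \<le> R \<omega>" for m
    proof -
      have "(of_nat m :: ennreal) \<le> of_nat (2 ^ (i0 + m))"
        by (intro of_nat_mono) (rule order_trans[OF less_imp_le[OF less_exp]], simp)
      also have "\<dots> \<le> R \<omega>"
        using R_ge[of m \<omega>] False by (simp add: A_def)
      finally show ?thesis .
    qed
    then have "R \<omega> = top"
      using ennreal_Ex_less_of_nat[of "R \<omega>"] by (meson leD top.not_eq_extremum)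
    then show ?thesis by simp
  qed
  then have "(\<integral>\<^sup>+ \<omega>. ennreal_of_enat (N \<omega>) \<partial>?P) \<le> (\<integral>\<^sup>+ \<omega>. R \<omega> \<partial>?P)"
    by (rule nn_integral_mono)
  also have "\<dots> = 2 ^ i0 * (1 + (\<Sum>k. 2 ^ k * emeasure ?P (A k)))"
    unfolding R_def
    by (simp add: nn_integral_cmult nn_integral_add nn_integral_suminf nn_integral_cmult_indicator emeasure_space_1)
  also have "\<dots> \<le> 2 ^ i0 * (1 + (\<Sum>k. ennreal (q * (2 * q) ^ k)))"
  proof (intro mult_left_mono add_left_mono suminf_le)
    fix k
    \<comment> \<open>Independence of the loops gives a product of \<open>k + 1\<close> factors,
      each at most \<open>q\<close>.\<close>
    have "emeasure ?P (A k) = (\<Prod>j\<in>{i0..i0 + k}. emeasure (measure_pmf (M j)) {x. \<not> success x})"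
      using emeasure_PiM_Collect[of "{i0..i0 + k}" "\<lambda>_. {x. \<not> success x}"] by (simp add: A_def space)
    also have "\<dots> = ennreal (\<Prod>j\<in>{i0..i0 + k}. measure_pmf.prob (M j) {x. \<not> success x})"
      by (simp add: measure_pmf.emeasure_eq_measure prod_ennreal)
    also have "\<dots> \<le> ennreal (\<Prod>j\<in>{i0..i0 + k}. q)"
      by (intro ennreal_leI prod_mono) (auto simp: fail)
    also have "\<dots> = ennreal (q ^ Suc k)"
      by simp
    finally have "2 ^ k * emeasure ?P (A k) \<le> ennreal (2 ^ k) * ennreal (q ^ Suc k)"
      by (intro mult_mono) (simp_all flip: ennreal_power)
    also have "\<dots> = ennreal (q * (2 * q) ^ k)"
      using q by (simp add: power_mult_distrib mult_ac flip: ennreal_mult)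
    finally show "2 ^ k * emeasure ?P (A k) \<le> ennreal (q * (2 * q) ^ k)" .
  qed auto
  also have "(\<Sum>k. ennreal (q * (2 * q) ^ k)) = ennreal (q / (1 - 2 * q))"
  proof (rule suminf_ennreal_eq)
    have "(\<lambda>k. q * (2 * q) ^ k) sums (q * (1 / (1 - 2 * q)))"
      using q by (intro sums_mult geometric_sums) auto
    then show "(\<lambda>k. q * (2 * q) ^ k) sums (q / (1 - 2 * q))" by simp
  qed (use q in auto)
  also have "2 ^ i0 * (1 + ennreal (q / (1 - 2 * q))) = ennreal (2 ^ i0 * (1 + q / (1 - 2 * q)))"
    using q by (simp add: ennreal_mult flip: ennreal_power)
  finally show ?thesis .
qed

lemma power_of_2_between:
  fixes x :: real
  assumes "1 \<le> x"
  obtains i where "x \<le> 2 ^ i" "2 ^ i \<le> 2 * x"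
proof -
  define i where "i = (LEAST i. x \<le> 2 ^ i)"
  have "\<exists>i. x \<le> 2 ^ i" using real_arch_pow[of 2 x] by (auto intro: less_imp_le)
  then have "x \<le> 2 ^ i" unfolding i_def by (rule LeastI_ex)
  moreover have "2 ^ i \<le> 2 * x"
  proof (cases i)
    case (Suc j)
    then have "\<not> x \<le> 2 ^ j" unfolding i_def by (metis lessI not_less_Least)
    then show ?thesis using Suc by simp
  qed (use assms in simp)
  ultimately show ?thesis using that by blast
qed

theorem proposition3p3:
  fixes P :: "'s::finite \<times> 'a::finite \<Rightarrow> 's pmf"
    and r :: "'s \<times> 'a \<Rightarrow> real"
    and Qstar Q0 :: "'s \<times> 'a \<Rightarrow> real"
    and greedy :: "('s \<times> 'a \<Rightarrow> real) \<Rightarrow> 's \<Rightarrow> 'a"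
    and c \<beta> :: "nat \<Rightarrow> real"
    and \<epsilon> \<delta> \<mu> :: real
  assumes "weakly_communicating P"
    and "\<And>sa. Qstar sa = bellman_op P r Qstar sa - gstar P r"
    and "\<epsilon> > 0"
    and "0 < \<delta>" and "\<delta> < 1"
    and "\<mu> = sp (\<lambda>sa. Q0 sa - Qstar sa)"
    and "\<And>k. c k = 5 * (real k + 2) * (ln (real k + 2))\<^sup>2"
    and "\<And>k. \<beta> k = real k / (real k + 2)"
    and "is_greedy_choice greedy"
  shows "(\<integral>\<^sup>+ \<omega>. ennreal_of_enat (savia_plus_N \<epsilon> \<omega>) \<partial>SAVIA_plus P r c \<beta> greedy Q0 \<epsilon> \<delta>)
           \<le> ennreal (2 * (1 + \<mu> / \<epsilon>) / (1 - \<delta>))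
       \<and> (AE \<omega> in SAVIA_plus P r c \<beta> greedy Q0 \<epsilon> \<delta>. savia_plus_N \<epsilon> \<omega> < \<infinity>)
       \<and> (AE \<omega> in SAVIA_plus P r c \<beta> greedy Q0 \<epsilon> \<delta>. \<exists>i. stops_at_loop \<epsilon> i \<omega>)"
proof -
  let ?M = "SAVIA_plus P r c \<beta> greedy Q0 \<epsilon> \<delta>"
  note fixpoint = assms(2) and \<epsilon> = assms(3) and \<delta> = assms(4,5) and \<mu> = assms(6) and c = assms(7)
    and \<beta> = assms(8)
  \<comment> \<open>This makes each confidence level at most \<open>\<delta> / 2\<close>, so that
    doubling gives the ratio \<open>2 * (\<delta> / 2) = \<delta> < 1\<close>.\<close>
  have c2: "2 \<le> c k" for k
  proof -
    have "4 / 9 = (2 / 3 :: real)\<^sup>2" by (simp add: power2_eq_square)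
    also have "\<dots> \<le> (ln 2)\<^sup>2" using ln2_ge_two_thirds by (intro power_mono) auto
    also have "\<dots> \<le> (ln (real k + 2))\<^sup>2" by (intro power_mono) auto
    finally have "2 * (4 / 9) \<le> (real k + 2) * (ln (real k + 2))\<^sup>2" by (intro mult_mono) auto
    then show ?thesis unfolding c mult.assoc by linarith
  qed
  then have c_pos: "0 < c k" for k using less_le_trans[of 0 2 "c k"] by simp
  have \<mu>0: "0 \<le> \<mu>" unfolding \<mu> by (rule sp_nonneg)
  \<comment> \<open>The lower bound puts the horizon of every loop from \<open>i0\<close> on above
    \<open>\<mu> / \<epsilon>\<close>; the upper bound supplies the factor 2 of the claim.\<close>
  obtain i0 where i0: "1 + \<mu> / \<epsilon> \<le> 2 ^ i0" "2 ^ i0 \<le> 2 * (1 + \<mu> / \<epsilon>)"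
    using power_of_2_between[of "1 + \<mu> / \<epsilon>"] \<mu>0 \<epsilon> by auto
  have fail: "measure_pmf.prob (SAVIA P r c \<beta> greedy Q0 (2 ^ i) \<epsilon> (\<delta> / c i)) {x. \<not> stop_criterion \<epsilon> x}
      \<le> \<delta> / 2" if "i \<ge> i0" for i
  proof -
    have \<delta>i: "0 < \<delta> / c i" "\<delta> / c i \<le> \<delta> / 2" "\<delta> / c i < 1"
      using \<delta> c2[of i] c_pos[of i] by (auto intro!: divide_left_mono simp: divide_simps)
    have "\<mu> / \<epsilon> \<le> 2 ^ i"
      using order_trans[OF i0(1) power_increasing[OF that, of "2::real"]] by simp
    then have "sp (\<lambda>sa. Q0 sa - Qstar sa) \<le> real (2 ^ i) * \<epsilon>"
      using \<epsilon> by (simp add: \<mu> divide_simps)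
    from SAVIA_stop_criterion[OF fixpoint \<beta> c_pos sum_inverse_c_le[OF c] \<epsilon> \<delta>i(1,3) this, of greedy]
    show ?thesis using \<delta>i(2) by linarith
  qed
  have "(\<integral>\<^sup>+ \<omega>. ennreal_of_enat (savia_plus_N \<epsilon> \<omega>) \<partial>?M)
      \<le> ennreal (2 ^ i0 * (1 + \<delta> / 2 / (1 - 2 * (\<delta> / 2))))"
    unfolding SAVIA_plus_def
    by (rule nn_integral_first_success_le[OF savia_plus_N_eq fail]) (use \<delta> in auto)
  \<comment> \<open>The bracket equals \<open>(1 - \<delta> / 2) / (1 - \<delta>)\<close>.\<close>
  also have "2 ^ i0 * (1 + \<delta> / 2 / (1 - 2 * (\<delta> / 2))) \<le> 2 * (1 + \<mu> / \<epsilon>) * (1 / (1 - \<delta>))"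
    using i0(2) \<delta> \<mu>0 \<epsilon> by (intro mult_mono) (auto simp: field_simps)
  finally have E: "(\<integral>\<^sup>+ \<omega>. ennreal_of_enat (savia_plus_N \<epsilon> \<omega>) \<partial>?M) \<le> ennreal (2 * (1 + \<mu> / \<epsilon>) / (1 - \<delta>))"
    by (simp add: ennreal_leI)
  \<comment> \<open>A finite expectation forces \<open>N\<close> to be finite almost surely; the
    least index meeting the criterion is then the stopping loop.\<close>
  have "AE \<omega> in ?M. ennreal_of_enat (savia_plus_N \<epsilon> \<omega>) \<noteq> \<infinity>"
  proof (rule nn_integral_PInf_AE)
    show "(\<lambda>\<omega>. ennreal_of_enat (savia_plus_N \<epsilon> \<omega>)) \<in> borel_measurable ?M"
      by (rule measurable_compose[OF measurable_savia_plus_N]) simp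
    show "(\<integral>\<^sup>+ \<omega>. ennreal_of_enat (savia_plus_N \<epsilon> \<omega>) \<partial>?M) \<noteq> \<infinity>"
      using E by (auto simp: top_unique)
  qed
  then have fin: "AE \<omega> in ?M. savia_plus_N \<epsilon> \<omega> < \<infinity>"
    by eventually_elim (metis ennreal_of_enat_infty enat_ord_simps(4))
  then have "AE \<omega> in ?M. \<exists>i. stops_at_loop \<epsilon> i \<omega>"
  proof eventually_elim
    fix \<omega> :: "nat \<Rightarrow> ('s, 'a) savia_output"
    assume "savia_plus_N \<epsilon> \<omega> < \<infinity>"
    then have "\<exists>i. stop_criterion \<epsilon> (\<omega> i)"
      by (auto simp: savia_plus_N_eq split: if_splits)
    then show "\<exists>i. stops_at_loop \<epsilon> i \<omega>"
      unfolding stops_at_loop_def using exists_least_iff[of "\<lambda>i. stop_criterion \<epsilon> (\<omega> i)"] by blast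
  qed
  with E fin show ?thesis by blast
qed

end
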